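(* Let $c\in\mathbb{R}$, $\lambda>0$ satisfy the sub-characteristic condition $\lambda>|c|$, and let $1\leq\omega\leq 2$. Consider, on the real line $\mathbb{R}$ (infinite domain) or on an interval with periodic boundary conditions, the over-relaxation D1Q2 scheme for the transport equation $\partial_t W+c\,\partial_x W=0$ described in the context, with time step $\Delta t>0$. Then the scheme is entropy stable: for every pair of square-integrable kinetic data $(F_1,F_2)$ at the beginning of a time step, the data $(F_1^+,F_2^+)$ at the end of the time step (after transport and relaxation) satisfy $$\int \big(s_1(F_1^+(x))+s_2(F_2^+(x))\big)\,dx\;\leq\;\int \big(s_1(F_1(x))+s_2(F_2(x))\big)\,dx .$$
   Context: The D1Q2 model for $\partial_t W+c\,\partial_x W=0$ has kinetic velocities $V_1=-\lambda$, $V_2=\lambda$, scalar kinetic unknowns $F_1,F_2$, conserved variable $W=F_1+F_2$, and equilibrium $$F_1^{\mathrm{eq}}(W)=\frac{W}{2}-\frac{cW}{2\lambda},\qquad F_2^{\mathrm{eq}}(W)=\frac{W}{2}+\frac{cW}{2\lambda}.$$ One time step of the over-relaxation scheme with relaxation parameter $\omega$, starting from $(F_1,F_2)$, consists of: (1) transport: $F_k^-(x)=F_k(x-\Delta t\,V_k)$, $k=1,2$ (exact solution of $\partial_t F_k+V_k\partial_xF_k=0$ for a duration $\Delta t$; translations are taken modulo the period in the periodic case); (2) relaxation: $W(x)=F_1^-(x)+F_2^-(x)$ and $F_k^+(x)=\omega F_k^{\mathrm{eq}}(W(x))+(1-\omega)F_k^-(x)$, $k=1,2$. The kinetic entropies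 are $$s_1(F_1)=\frac{\lambda}{\lambda-c}F_1^2,\qquad s_2(F_2)=\frac{\lambda}{\lambda+c}F_2^2 .$$ The integrals are over the whole domain (over one period in the periodic case). *)

theory Defs
  imports "HOL-Analysis.Analysis"
begin

text \<open>
  The spatial domain is either the whole line, or an interval with periodic boundary conditions.
  The latter is represented by \<open>{a..<b}\<close>, so that each point of the circle of length \<open>b - a\<close>
  occurs exactly once; \<open>wrap\<close> reduces a real number modulo the period to its representative
  in the domain. Values of kinetic data outside the domain are never used.
\<close>

datatype spatial_domain = Line | Periodic real real

fun admissible :: "spatial_domain \<Rightarrow> bool" where
  "admissible Line \<longleftrightarrow> True"
| "admissible (Periodic a b) \<longleftrightarrow> a < b"

fun points :: "spatial_domain \<Rightarrow> real set" where
  "points Line = UNIV"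
| "points (Periodic a b) = {a..<b}"

fun wrap :: "spatial_domain \<Rightarrow> real \<Rightarrow> real" where
  "wrap Line x = x"
| "wrap (Periodic a b) x = a + (b - a) * frac ((x - a) / (b - a))"

abbreviation lebesgue_of :: "spatial_domain \<Rightarrow> real measure" where
  "lebesgue_of D \<equiv> lebesgue_on (points D)"

definition square_integrable :: "spatial_domain \<Rightarrow> (real \<Rightarrow> real) \<Rightarrow> bool" where
  "square_integrable D f \<longleftrightarrow>
     f \<in> borel_measurable (lebesgue_of D) \<and> integrable (lebesgue_of D) (\<lambda>x. (f x)\<^sup>2)"

definition velocity1 :: "real \<Rightarrow> real" where
  "velocity1 lam = - lam"

definition velocity2 :: "real \<Rightarrow> real" where
  "velocity2 lam = lam"

definition equilibrium1 :: "real \<Rightarrow> real \<Rightarrow> real \<Rightarrow> real" where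
  "equilibrium1 c lam W = W / 2 - c * W / (2 * lam)"

definition equilibrium2 :: "real \<Rightarrow> real \<Rightarrow> real \<Rightarrow> real" where
  "equilibrium2 c lam W = W / 2 + c * W / (2 * lam)"

definition transport ::
    "spatial_domain \<Rightarrow> real \<Rightarrow> real \<Rightarrow> (real \<Rightarrow> real) \<Rightarrow> real \<Rightarrow> real" where
  "transport D dt V F x = F (wrap D (x - dt * V))"

definition relaxation ::
    "real \<Rightarrow> real \<Rightarrow> real \<Rightarrow> (real \<Rightarrow> real) \<times> (real \<Rightarrow> real) \<Rightarrow> (real \<Rightarrow> real) \<times> (real \<Rightarrow> real)" where
  "relaxation c lam om = (\<lambda>(G1, G2).
     let W = (\<lambda>x. G1 x + G2 x) in
       (\<lambda>x. om * equilibrium1 c lam (W x) + (1 - om) * G1 x,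
        \<lambda>x. om * equilibrium2 c lam (W x) + (1 - om) * G2 x))"

definition d1q2_step ::
    "spatial_domain \<Rightarrow> real \<Rightarrow> real \<Rightarrow> real \<Rightarrow> real \<Rightarrow>
      (real \<Rightarrow> real) \<times> (real \<Rightarrow> real) \<Rightarrow> (real \<Rightarrow> real) \<times> (real \<Rightarrow> real)" where
  "d1q2_step D c lam om dt = (\<lambda>(F1, F2).
     relaxation c lam om (transport D dt (velocity1 lam) F1, transport D dt (velocity2 lam) F2))"

definition entropy1 :: "real \<Rightarrow> real \<Rightarrow> real \<Rightarrow> real" where
  "entropy1 c lam f = lam / (lam - c) * f\<^sup>2"

definition entropy2 :: "real \<Rightarrow> real \<Rightarrow> real \<Rightarrow> real" where
  "entropy2 c lam f = lam / (lam + c) * f\<^sup>2"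

end

theory Submission
  imports Defs
begin

text \<open>
  Transport is a measure-preserving rearrangement of the domain, so it leaves both entropies
  unchanged. Relaxation fixes \<open>W\<close> and multiplies the deviation from equilibrium by \<open>1 - \<omega>\<close>, whose
  modulus is at most 1. The entropy is a weighted sum of squares for which the equilibrium line
  is orthogonal to the directions \<open>(d, -d)\<close>, so shrinking the deviation does not increase it.
\<close>

section \<open>Shifts modulo the period preserve Lebesgue measure\<close>

lemma emeasure_lebesgue_translation_real:
  fixes A :: "real set"
  shows "emeasure lebesgue ((+) s ` A) = emeasure lebesgue A"
  using emeasure_lebesgue_affine[of 1 s A] by (simp add: add.commute)

text \<open>A fractional part is determined by lying in the interval from 0 (included) to 1
  (excluded) and differing from the argument by an integer. Evaluating \<open>wrap\<close> thus
  reduces to exhibiting the number \<open>k\<close> of periods to remove.\<close>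

lemma wrap_Periodic_eqI:
  assumes "a \<le> y" "y < b" and "x = y + of_int k * (b - a)"
  shows "wrap (Periodic a b) x = y"
proof -
  have "frac ((x - a) / (b - a)) = (y - a) / (b - a)"
  proof (subst frac_unique_iff, intro conjI)
    have "(x - a) / (b - a) - (y - a) / (b - a) = (x - y) / (b - a)"
      by (simp flip: diff_divide_distrib)
    also have "\<dots> = of_int k"
      using assms by simp
    finally have "(x - a) / (b - a) - (y - a) / (b - a) = of_int k" .
    then show "(x - a) / (b - a) - (y - a) / (b - a) \<in> \<int>" by simp
  qed (use assms in auto)
  then show ?thesis using assms by simp
qed

text \<open>
  The shift by \<open>dt * V\<close> is congruent modulo the period to a shift \<open>s\<close> with \<open>0 \<le> s < b - a\<close>, which
  swaps the two pieces \<open>{a..<b - s}\<close> and \<open>{b - s..<b}\<close>, each by a translation.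
\<close>

lemma Periodic_shift_preimage:
  assumes "a < b" and "A \<subseteq> {a..<b}"
  obtains s where "0 \<le> s" "s < b - a"
    "(\<lambda>x. wrap (Periodic a b) (x - t)) -` A \<inter> {a..<b} =
      (+) s ` (A \<inter> {a..<b - s}) \<union> (+) (s - (b - a)) ` (A \<inter> {b - s..<b})"
proof -
  \<comment> \<open>Division of \<open>t\<close> by the period: \<open>k\<close> whole periods and
    the remainder \<open>s\<close>.\<close>
  define k s where "k = \<lfloor>t / (b - a)\<rfloor>" and "s = (b - a) * frac (t / (b - a))"
  have t: "t = s + of_int k * (b - a)"
    using assms(1) by (simp add: k_def s_def frac_def right_diff_distrib[of "b - a"])
  have s: "0 \<le> s" "s < b - a"
    using assms frac_lt_1[of "t / (b - a)"] by (auto simp: s_def)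
  have low: "wrap (Periodic a b) (x - t) = x - s" if "a + s \<le> x" "x < b" for x
    using that s by (intro wrap_Periodic_eqI[where k = "-k"]) (auto simp: t)
  \<comment> \<open>Here \<open>x - s\<close> falls below \<open>a\<close>, so one more period has
    to be added to return to the domain; hence \<open>-k - 1\<close> in place of
    \<open>-k\<close>.\<close>
  have high: "wrap (Periodic a b) (x - t) = x - s + (b - a)" if "a \<le> x" "x < a + s" for x
    using that s by (intro wrap_Periodic_eqI[where k = "-k - 1"]) (auto simp: t algebra_simps)
  have "x \<in> (+) s ` (A \<inter> {a..<b - s}) \<union> (+) (s - (b - a)) ` (A \<inter> {b - s..<b})"
    if "a \<le> x" "x < b" "wrap (Periodic a b) (x - t) \<in> A" for x
  proof (cases "a + s \<le> x")
    case True
    then have "x - s \<in> A \<inter> {a..<b - s}"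
      using that low[of x] by (auto simp del: wrap.simps)
    then have "s + (x - s) \<in> (+) s ` (A \<inter> {a..<b - s})" by (rule imageI)
    then show ?thesis by simp
  next
    case False
    then have "x - s + (b - a) \<in> A \<inter> {b - s..<b}"
      using that high[of x] by (auto simp del: wrap.simps)
    then have "s - (b - a) + (x - s + (b - a)) \<in> (+) (s - (b - a)) ` (A \<inter> {b - s..<b})"
      by (rule imageI)
    then show ?thesis by simp
  qed
  then have "(\<lambda>x. wrap (Periodic a b) (x - t)) -` A \<inter> {a..<b} \<subseteq>
      (+) s ` (A \<inter> {a..<b - s}) \<union> (+) (s - (b - a)) ` (A \<inter> {b - s..<b})"
    by (intro subsetI) (simp del: wrap.simps Un_iff)
  moreover have "(\<lambda>x. wrap (Periodic a b) (x - t)) -` A \<inter> {a..<b} \<supseteq>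
      (+) s ` (A \<inter> {a..<b - s}) \<union> (+) (s - (b - a)) ` (A \<inter> {b - s..<b})"
  proof -
    have "wrap (Periodic a b) (s + y - t) = y" if "y \<in> A" "y < b - s" for y
      using that s assms low[of "s + y"] by (auto simp del: wrap.simps)
    moreover have "wrap (Periodic a b) (s - (b - a) + y - t) = y" if "y \<in> A" "b - s \<le> y" for y
      using that s assms high[of "s - (b - a) + y"] by (auto simp del: wrap.simps)
    ultimately show ?thesis
      using s assms by (auto simp del: wrap.simps)
  qed
  ultimately show ?thesis
    using s that[of s] by (simp only: antisym)
qed

lemma points_sets_lebesgue [simp]: "points D \<in> sets lebesgue"
  by (cases D) auto

text \<open>On the line the preimage is a translate of \<open>A\<close>; on the circle it consists
  of translates of two disjoint pieces of \<open>A\<close>. Translation invariance and additivity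
  give the measure.\<close>

lemma shift_preimage:
  fixes t :: real
  assumes "admissible D" "A \<in> sets lebesgue" "A \<subseteq> points D"
  defines "P \<equiv> (\<lambda>x. wrap D (x - t)) -` A \<inter> points D"
  shows "P \<in> sets lebesgue \<and> emeasure lebesgue P = emeasure lebesgue A"
proof (cases D)
  case Line
  have "P = (+) t ` A"
    by (auto simp: P_def Line image_iff intro!: bexI[where x = "_ - t"])
  then show ?thesis
    using assms lebesgue_sets_translation emeasure_lebesgue_translation_real by simp
next
  case (Periodic a b)
  have ab: "a < b" "A \<subseteq> {a..<b}" using assms Periodic by auto
  obtain s where s: "0 \<le> s" "s < b - a"
    and "(\<lambda>x. wrap (Periodic a b) (x - t)) -` A \<inter> {a..<b} =
      (+) s ` (A \<inter> {a..<b - s}) \<union> (+) (s - (b - a)) ` (A \<inter> {b - s..<b})"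
    using Periodic_shift_preimage[OF ab] by metis
  then have P: "P = (+) s ` (A \<inter> {a..<b - s}) \<union> (+) (s - (b - a)) ` (A \<inter> {b - s..<b})"
    by (simp add: P_def Periodic)
  have pieces: "A \<inter> {a..<b - s} \<in> sets lebesgue" "A \<inter> {b - s..<b} \<in> sets lebesgue"
    using assms(2) by auto
  note images = pieces[THEN lebesgue_sets_translation]
  \<comment> \<open>The first image lies in \<open>{a + s..<b}\<close>, the second in
    \<open>{a..<a + s}\<close>; the half-open intervals keep them disjoint.\<close>
  have "(+) s ` (A \<inter> {a..<b - s}) \<inter> (+) (s - (b - a)) ` (A \<inter> {b - s..<b}) = {}"
    by auto
  then have "emeasure lebesgue P =
      emeasure lebesgue (A \<inter> {a..<b - s}) + emeasure lebesgue (A \<inter> {b - s..<b})"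
    unfolding P using images
    by (subst plus_emeasure[symmetric]) (auto simp: emeasure_lebesgue_translation_real)
  also have "\<dots> = emeasure lebesgue (A \<inter> {a..<b - s} \<union> A \<inter> {b - s..<b})"
    using pieces by (intro plus_emeasure) auto
  also have "A \<inter> {a..<b - s} \<union> A \<inter> {b - s..<b} = A"
    using ab s by auto
  finally show ?thesis using P images by auto
qed

lemma wrap_in_points: "admissible D \<Longrightarrow> wrap D x \<in> points D"
proof (cases D)
  case (Periodic a b)
  assume "admissible D"
  then have "a < b" by (simp add: Periodic)
  then have "(b - a) * frac ((x - a) / (b - a)) < (b - a) * 1"
    by (intro mult_strict_left_mono frac_lt_1) simp
  then have "a + (b - a) * frac ((x - a) / (b - a)) < b"
    unfolding mult_1_right by linarith
  with \<open>a < b\<close> show ?thesis by (simp add: Periodic)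
qed simp

lemma shift_measurable:
  assumes "admissible D"
  shows "(\<lambda>x. wrap D (x - t)) \<in> measurable (lebesgue_of D) (lebesgue_of D)"
proof (rule measurableI)
  fix A assume "A \<in> sets (lebesgue_of D)"
  then show "(\<lambda>x. wrap D (x - t)) -` A \<inter> space (lebesgue_of D) \<in> sets (lebesgue_of D)"
    using shift_preimage[OF assms] by (auto simp: sets_restrict_space_iff space_restrict_space)
qed (use wrap_in_points[OF assms] in \<open>auto simp: space_restrict_space\<close>)

text \<open>Invariance of preimages is recast as invariance of the push-forward measure, the form
  required for changing variables in integrals.\<close>

lemma distr_shift:
  assumes "admissible D"
  shows "distr (lebesgue_of D) (lebesgue_of D) (\<lambda>x. wrap D (x - t)) = lebesgue_of D"
proof (rule measure_eqI)
  fix A assume "A \<in> sets (distr (lebesgue_of D) (lebesgue_of D) (\<lambda>x. wrap D (x - t)))"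
  then have A: "A \<in> sets (lebesgue_of D)" by simp
  then have "A \<in> sets lebesgue" "A \<subseteq> points D"
    by (auto simp: sets_restrict_space_iff)
  with A show "emeasure (distr (lebesgue_of D) (lebesgue_of D) (\<lambda>x. wrap D (x - t))) A =
      emeasure (lebesgue_of D) A"
    using shift_preimage[OF assms]
    by (simp add: emeasure_distr shift_measurable[OF assms] emeasure_restrict_space
        space_restrict_space del: emeasure_completion)
qed simp

section \<open>Square-integrable data under transport and linear combination\<close>

lemma transport_square_integrable:
  assumes "admissible D" "square_integrable D F"
  shows "square_integrable D (transport D dt V F)"
    and "(\<integral>x. (transport D dt V F x)\<^sup>2 \<partial>lebesgue_of D) = (\<integral>x. (F x)\<^sup>2 \<partial>lebesgue_of D)"
proof -
  note m = shift_measurable[OF assms(1), of "dt * V"]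
  have F: "F \<in> borel_measurable (lebesgue_of D)" "integrable (lebesgue_of D) (\<lambda>x. (F x)\<^sup>2)"
    using assms(2) by (auto simp: square_integrable_def)
  have "integrable (lebesgue_of D) (\<lambda>x. (F (wrap D (x - dt * V)))\<^sup>2)"
    using F by (intro integrable_distr[OF m]) (simp add: distr_shift[OF assms(1)])
  then show "square_integrable D (transport D dt V F)"
    using measurable_compose[OF m F(1)] by (simp add: square_integrable_def transport_def[abs_def])
  show "(\<integral>x. (transport D dt V F x)\<^sup>2 \<partial>lebesgue_of D) = (\<integral>x. (F x)\<^sup>2 \<partial>lebesgue_of D)"
    using integral_distr[OF m, of "\<lambda>x. (F x)\<^sup>2"] F by (simp add: distr_shift[OF assms(1)] transport_def)
qed

lemma square_integrable_lincomb:
  assumes "square_integrable D f" "square_integrable D g"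
  shows "square_integrable D (\<lambda>x. p * f x + q * g x)"
proof -
  have m: "f \<in> borel_measurable (lebesgue_of D)" "g \<in> borel_measurable (lebesgue_of D)"
    and i: "integrable (lebesgue_of D) (\<lambda>x. (f x)\<^sup>2)" "integrable (lebesgue_of D) (\<lambda>x. (g x)\<^sup>2)"
    using assms by (auto simp: square_integrable_def)
  note [measurable] = m
  have "integrable (lebesgue_of D) (\<lambda>x. (p * f x + q * g x)\<^sup>2)"
  proof (rule Bochner_Integration.integrable_bound)
    show "integrable (lebesgue_of D) (\<lambda>x. 2 * p\<^sup>2 * (f x)\<^sup>2 + 2 * q\<^sup>2 * (g x)\<^sup>2)"
      using i by simp
    \<comment> \<open>The right side minus the left side is
      \<open>(p * f x - q * g x)\<^sup>2\<close>.\<close>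
    have "(p * f x + q * g x)\<^sup>2 \<le> 2 * p\<^sup>2 * (f x)\<^sup>2 + 2 * q\<^sup>2 * (g x)\<^sup>2" for x
      using zero_le_power2[of "p * f x - q * g x"]
      by (simp add: power2_sum power2_diff power_mult_distrib)
    then show "AE x in lebesgue_of D. norm ((p * f x + q * g x)\<^sup>2)
        \<le> norm (2 * p\<^sup>2 * (f x)\<^sup>2 + 2 * q\<^sup>2 * (g x)\<^sup>2)"
      by (intro AE_I2) (force intro: order_trans[OF _ abs_ge_self])
  qed measurable
  then show ?thesis unfolding square_integrable_def by simp
qed

section \<open>Pointwise entropy decay under relaxation\<close>

lemma relaxation_entropy_le:
  assumes "lam > \<bar>c\<bar>" "1 \<le> om" "om \<le> 2"
  shows "entropy1 c lam (om * equilibrium1 c lam (u + v) + (1 - om) * u)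
      + entropy2 c lam (om * equilibrium2 c lam (u + v) + (1 - om) * v)
    \<le> entropy1 c lam u + entropy2 c lam v"
proof -
  define d where "d = u - equilibrium1 c lam (u + v)"
  define W where "W = u + v"
  define K where "K = lam / (lam - c) + lam / (lam + c)"
  have pos: "lam > 0" "lam - c > 0" "lam + c > 0" using assms by auto
  have eq: "equilibrium1 c lam W = (lam - c) / (2 * lam) * W"
    "equilibrium2 c lam W = (lam + c) / (2 * lam) * W"
    using pos by (auto simp: equilibrium1_def equilibrium2_def field_simps)
  have dev: "u = equilibrium1 c lam W + d" "v = equilibrium2 c lam W - d"
    by (auto simp: d_def W_def equilibrium1_def equilibrium2_def field_simps)
  \<comment> \<open>The entropy weights are inverse to the equilibrium slopes up to a common factor,
    so the cross terms are \<open>W * e\<close> and \<open>- W * e\<close> and cancel. What remains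
    is the equilibrium entropy plus a nonnegative multiple of the squared deviation.\<close>
  have pythagoras: "entropy1 c lam (equilibrium1 c lam W + e) + entropy2 c lam (equilibrium2 c lam W - e)
      = W\<^sup>2 / 2 + K * e\<^sup>2" for e
  proof -
    have "entropy1 c lam (equilibrium1 c lam W + e)
        = (lam - c) / (4 * lam) * W\<^sup>2 + W * e + lam / (lam - c) * e\<^sup>2"
      using pos by (simp add: entropy1_def eq power2_eq_square divide_simps) algebra
    moreover have "entropy2 c lam (equilibrium2 c lam W - e)
        = (lam + c) / (4 * lam) * W\<^sup>2 - W * e + lam / (lam + c) * e\<^sup>2"
      using pos by (simp add: entropy2_def eq power2_eq_square divide_simps) algebra
    moreover have "(lam - c) / (4 * lam) * W\<^sup>2 + (lam + c) / (4 * lam) * W\<^sup>2 = W\<^sup>2 / 2"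
      using pos by (simp add: field_simps)
    ultimately show ?thesis by (simp add: K_def distrib_right)
  qed
  \<comment> \<open>Since the equilibria sum to \<open>W\<close>, the two deviations are
    \<open>d\<close> and \<open>-d\<close>; relaxation scales both by \<open>1 - om\<close>.\<close>
  have "om * equilibrium1 c lam W + (1 - om) * u = equilibrium1 c lam W + (1 - om) * d"
    "om * equilibrium2 c lam W + (1 - om) * v = equilibrium2 c lam W - (1 - om) * d"
    by (subst dev, algebra)+
  then have "entropy1 c lam (om * equilibrium1 c lam W + (1 - om) * u)
      + entropy2 c lam (om * equilibrium2 c lam W + (1 - om) * v)
    = W\<^sup>2 / 2 + K * ((1 - om) * d)\<^sup>2"
    using pythagoras[of "(1 - om) * d"] by simp
  also have "\<dots> \<le> W\<^sup>2 / 2 + K * d\<^sup>2"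
  proof -
    \<comment> \<open>The range of \<open>om\<close> enters here: \<open>1 - om\<close> lies between
      -1 and 0.\<close>
    have "(1 - om)\<^sup>2 \<le> 1" using assms by (simp add: abs_square_le_1)
    then have "((1 - om) * d)\<^sup>2 \<le> d\<^sup>2"
      by (simp add: power_mult_distrib mult_left_le_one_le)
    moreover have "K \<ge> 0" using pos by (simp add: K_def)
    ultimately show ?thesis by (simp add: mult_left_mono)
  qed
  also have "\<dots> = entropy1 c lam u + entropy2 c lam v"
    using pythagoras[of d] dev by simp
  finally show ?thesis by (simp add: W_def)
qed

text \<open>Both entropies are constant multiples of squares, so the total entropy depends on the
  data only through the two squared norms, which transport preserves.\<close>

lemma integral_entropy:
  assumes "square_integrable D f" "square_integrable D g"
  shows "integrable (lebesgue_of D) (\<lambda>x. entropy1 c lam (f x) + entropy2 c lam (g x))"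
    and "(\<integral>x. entropy1 c lam (f x) + entropy2 c lam (g x) \<partial>lebesgue_of D)
      = lam / (lam - c) * (\<integral>x. (f x)\<^sup>2 \<partial>lebesgue_of D)
        + lam / (lam + c) * (\<integral>x. (g x)\<^sup>2 \<partial>lebesgue_of D)"
  using assms by (simp_all add: square_integrable_def entropy1_def entropy2_def)

(* The Bochner integral of a non-integrable function is 0 by convention; square-integrability of
   the updated data is therefore part of the conclusion, so that the left-hand integral is genuine. *)
theorem theorem8:
  fixes c lam om dt :: real
    and D :: spatial_domain
    and F1 F2 F1' F2' :: "real \<Rightarrow> real"
  assumes "lam > 0"
    and "lam > \<bar>c\<bar>"
    and "1 \<le> om" and "om \<le> 2"
    and "dt > 0"
    and "admissible D"
    and "square_integrable D F1" and "square_integrable D F2"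
    and "(F1', F2') = d1q2_step D c lam om dt (F1, F2)"
  shows "square_integrable D F1' \<and> square_integrable D F2' \<and>
    (\<integral>x. entropy1 c lam (F1' x) + entropy2 c lam (F2' x) \<partial>(lebesgue_of D))
      \<le> (\<integral>x. entropy1 c lam (F1 x) + entropy2 c lam (F2 x) \<partial>(lebesgue_of D))"
proof -
  define G1 G2 where "G1 = transport D dt (velocity1 lam) F1"
    and "G2 = transport D dt (velocity2 lam) F2"
  note G = transport_square_integrable[OF \<open>admissible D\<close> \<open>square_integrable D F1\<close>,
      of dt "velocity1 lam", folded G1_def]
    transport_square_integrable[OF \<open>admissible D\<close> \<open>square_integrable D F2\<close>,
      of dt "velocity2 lam", folded G2_def]
  have F': "F1' = (\<lambda>x. om * equilibrium1 c lam (G1 x + G2 x) + (1 - om) * G1 x)"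
    "F2' = (\<lambda>x. om * equilibrium2 c lam (G1 x + G2 x) + (1 - om) * G2 x)"
    using assms(9) by (auto simp: d1q2_step_def relaxation_def Let_def G1_def G2_def)
  \<comment> \<open>The equilibria are linear in \<open>W\<close>, so each relaxed component is a
    combination of \<open>G1\<close> and \<open>G2\<close> with constant coefficients and stays
    square-integrable.\<close>
  have "F1' = (\<lambda>x. (om * (1 / 2 - c / (2 * lam)) + (1 - om)) * G1 x
      + om * (1 / 2 - c / (2 * lam)) * G2 x)"
    by (rule ext) (simp add: F' equilibrium1_def algebra_simps add_divide_distrib)
  then have sq1: "square_integrable D F1'"
    using square_integrable_lincomb G by simp
  have "F2' = (\<lambda>x. om * (1 / 2 + c / (2 * lam)) * G1 x
      + (om * (1 / 2 + c / (2 * lam)) + (1 - om)) * G2 x)"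
    by (rule ext) (simp add: F' equilibrium2_def algebra_simps add_divide_distrib)
  then have sq2: "square_integrable D F2'"
    using square_integrable_lincomb G by simp
  \<comment> \<open>Integrability of both sides makes the pointwise inequality pass to the
    integrals.\<close>
  have "(\<integral>x. entropy1 c lam (F1' x) + entropy2 c lam (F2' x) \<partial>(lebesgue_of D))
      \<le> (\<integral>x. entropy1 c lam (G1 x) + entropy2 c lam (G2 x) \<partial>(lebesgue_of D))"
    using relaxation_entropy_le[OF assms(2-4)] sq1 sq2 G
    by (intro integral_mono integral_entropy(1)) (auto simp: F')
  also have "\<dots> = (\<integral>x. entropy1 c lam (F1 x) + entropy2 c lam (F2 x) \<partial>(lebesgue_of D))"
    using G assms(7,8) by (simp add: integral_entropy(2))
  finally show ?thesis using sq1 sq2 by blast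
qed

end
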